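(* Let $k \geq 2$ and let $(\mathcal{H}_n)_{n \in \mathbb{N}}$ be a sequence of $k$-uniform hypergraphs satisfying, as $n \to \infty$, (M1) $\Delta_1(\mathcal{H}_n) = O(d(\mathcal{H}_n))$, (M2) $\Delta_2(\mathcal{H}_n) = o(d(\mathcal{H}_n))$, and (M3) $d(\mathcal{H}_n) = o(v(\mathcal{H}_n)^{k-1})$. Then the threshold biases satisfy $$q(\mathcal{H}_n) = \Omega\left( \min_{2 \leq \ell \leq k} \left( \frac{d(\mathcal{H}_n)}{\Delta_\ell(\mathcal{H}_n)} \right)^{\frac{1}{\ell-1}} \right).$$
   Context: For a hypergraph $\mathcal{H}$, $v(\mathcal{H})$ is the number of vertices, $e(\mathcal{H})$ the number of edges, and $d(\mathcal{H}) = e(\mathcal{H})/v(\mathcal{H})$ its density. For $S \subseteq V(\mathcal{H})$, $\deg(S)$ is the number of edges containing $S$, and $\Delta_\ell(\mathcal{H}) = \max\{\deg(S) : S \subseteq V(\mathcal{H}), |S| = \ell\}$. For a positive integer $q$, the $q$-biased Maker-Breaker game $\mathbf{G}(\mathcal{H};q)$: Maker and Breaker alternately occupy previously unoccupied vertices of $\mathcal{H}$, Maker first, Maker occupying one vertex per round and Breaker up to $q$ vertices per round; Maker wins if his vertices fully contain some edge of $\mathcal{H}$, Breaker wins otherwise. The threshold bias $q(\mathcal{H})$ is the smallest positive integer $q$ for which Breaker has a winning strategy in $\mathbf{G}(\mathcal{H};q)$. *)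

theory Defs
  imports Complex_Main "HOL-Library.Landau_Symbols"
begin

record 'a hypergraph =
  hverts :: "'a set"
  hedges :: "'a set set"

definition uniform_hypergraph :: "nat \<Rightarrow> 'a hypergraph \<Rightarrow> bool" where
  "uniform_hypergraph k H \<longleftrightarrow>
     finite (hverts H) \<and> (\<forall>e\<in>hedges H. e \<subseteq> hverts H \<and> card e = k)"

definition num_verts :: "'a hypergraph \<Rightarrow> nat" where
  "num_verts H = card (hverts H)"

definition num_edges :: "'a hypergraph \<Rightarrow> nat" where
  "num_edges H = card (hedges H)"

definition density :: "'a hypergraph \<Rightarrow> real" where
  "density H = real (num_edges H) / real (num_verts H)"

definition hdeg :: "'a hypergraph \<Rightarrow> 'a set \<Rightarrow> nat" where
  "hdeg H S = card {e \<in> hedges H. S \<subseteq> e}"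

text \<open>If \<open>H\<close> has fewer than \<open>l\<close> vertices, this is the maximum of an empty set and hence
  unspecified. For a \<open>k\<close>-uniform \<open>H\<close> and \<open>l \<le> k\<close> this requires \<open>H\<close> to have no edges at all.\<close>

definition max_deg :: "nat \<Rightarrow> 'a hypergraph \<Rightarrow> nat" where
  "max_deg l H = Max {hdeg H S | S. S \<subseteq> hverts H \<and> card S = l}"


text \<open>A history is the list of completed rounds, oldest first; each round consists of Maker's vertex
  and the set of vertices with which Breaker replies.\<close>

type_synonym 'a history = "('a \<times> 'a set) list"

definition maker_set :: "'a history \<Rightarrow> 'a set" where
  "maker_set h = fst ` set h"

definition breaker_set :: "'a history \<Rightarrow> 'a set" where
  "breaker_set h = \<Union> (snd ` set h)"

definition free_verts :: "'a hypergraph \<Rightarrow> 'a history \<Rightarrow> 'a set" where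
  "free_verts H h = hverts H - (maker_set h \<union> breaker_set h)"

text \<open>A strategy of Breaker maps the history and Maker's move in the current round to Breaker's
  reply.\<close>

type_synonym 'a breaker_strategy = "'a history \<Rightarrow> 'a \<Rightarrow> 'a set"

inductive play_against :: "'a hypergraph \<Rightarrow> 'a breaker_strategy \<Rightarrow> 'a history \<Rightarrow> bool"
  for H :: "'a hypergraph" and \<sigma> :: "'a breaker_strategy" where
  start: "play_against H \<sigma> []"
| round: "play_against H \<sigma> h \<Longrightarrow> v \<in> free_verts H h \<Longrightarrow> play_against H \<sigma> (h @ [(v, \<sigma> h v)])"

definition legal_breaker_strategy :: "'a hypergraph \<Rightarrow> nat \<Rightarrow> 'a breaker_strategy \<Rightarrow> bool" where
  "legal_breaker_strategy H q \<sigma> \<longleftrightarrow>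
     (\<forall>h v. play_against H \<sigma> h \<longrightarrow> v \<in> free_verts H h \<longrightarrow>
        \<sigma> h v \<subseteq> free_verts H h - {v} \<and> card (\<sigma> h v) \<le> q)"

definition maker_has_won :: "'a hypergraph \<Rightarrow> 'a history \<Rightarrow> bool" where
  "maker_has_won H h \<longleftrightarrow> (\<exists>e\<in>hedges H. e \<subseteq> maker_set h)"

text \<open>Play may be continued after Maker has completed an edge; this changes nothing, since
  \<open>maker_has_won\<close> is preserved when a history is extended.\<close>

definition breaker_wins :: "'a hypergraph \<Rightarrow> nat \<Rightarrow> bool" where
  "breaker_wins H q \<longleftrightarrow>
     (\<exists>\<sigma>. legal_breaker_strategy H q \<sigma> \<and> (\<forall>h. play_against H \<sigma> h \<longrightarrow> \<not> maker_has_won H h))"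

definition threshold_bias :: "'a hypergraph \<Rightarrow> nat" where
  "threshold_bias H = (LEAST q. q > 0 \<and> breaker_wins H q)"

text \<open>For \<open>k \<ge> 2\<close> the minimum in \<open>threshold_bias\<close> exists: a sufficiently strong Breaker answers
  Maker's first move by occupying all remaining vertices.\<close>

lemma breaker_wins_large_bias:
  assumes H: "uniform_hypergraph k H" and k: "k \<ge> 2" and q: "q \<ge> num_verts H"
  shows "breaker_wins H q"
proof -
  define \<sigma> :: "'a breaker_strategy" where "\<sigma> = (\<lambda>h v. free_verts H h - {v})"
  have fin: "finite (hverts H)" using H by (simp add: uniform_hypergraph_def)
  have legal: "legal_breaker_strategy H q \<sigma>"
    unfolding legal_breaker_strategy_def
  proof (intro allI impI conjI)
    fix h v
    show "\<sigma> h v \<subseteq> free_verts H h - {v}" by (simp add: \<sigma>_def)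
    have "card (\<sigma> h v) \<le> card (hverts H)"
      by (rule card_mono[OF fin]) (auto simp: \<sigma>_def free_verts_def)
    then show "card (\<sigma> h v) \<le> q" using q by (simp add: num_verts_def)
  qed
  have short: "h = [] \<or> length h = 1 \<and> free_verts H h = {}" if "play_against H \<sigma> h" for h
    using that
  proof induction
    case start
    show ?case by simp
  next
    case (round h v)
    then have "h = []" by auto
    then show ?case
      by (auto simp: free_verts_def maker_set_def breaker_set_def \<sigma>_def)
  qed
  have "\<not> maker_has_won H h" if "play_against H \<sigma> h" for h
  proof
    assume "maker_has_won H h"
    then obtain e where e: "e \<in> hedges H" "e \<subseteq> maker_set h"
      by (auto simp: maker_has_won_def)
    have "card e \<le> card (maker_set h)"
      using e(2) by (intro card_mono) (simp_all add: maker_set_def)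
    also have "\<dots> \<le> card (set h)" by (simp add: maker_set_def card_image_le)
    also have "\<dots> \<le> length h" by (rule card_length)
    also have "\<dots> \<le> 1" using short[OF that] by auto
    finally show False using e(1) H k by (auto simp: uniform_hypergraph_def)
  qed
  with legal show ?thesis unfolding breaker_wins_def by blast
qed

lemma threshold_bias_pos_wins:
  assumes "uniform_hypergraph k H" and "k \<ge> 2"
  shows "threshold_bias H > 0 \<and> breaker_wins H (threshold_bias H)"
  unfolding threshold_bias_def
  by (rule LeastI[of _ "Suc (num_verts H)"])
    (use breaker_wins_large_bias[OF assms, of "Suc (num_verts H)"] in simp)

end

theory Submission
  imports Defs "HOL-Library.Ramsey" "HOL-Analysis.Convex"
begin

text \<open>
  Let \<open>\<mu>\<close> be the minimum in the lower bound and suppose that \<open>q \<le> \<epsilon> \<mu>\<close>. Fix a strategy of Breaker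
  and let Maker attempt \<open>m \<approx> k v / \<mu>\<close> vertices chosen independently and uniformly at random. An
  attempt fails only if Breaker already owns the vertex, which has probability at most
  \<open>\<delta> = q m / v = O(\<epsilon>)\<close>. If Maker never completes an edge, then every \<open>k\<close>-set of attempts that
  spells an edge contains a failed attempt. The expected number of such \<open>k\<close>-sets is of order
  \<open>Y = e (m / v)\<^sup>k\<close>. The number \<open>D\<^sub>i\<close> of those containing attempt \<open>i\<close> is not bounded pointwise, but
  the choice of \<open>m\<close> ensures \<open>\<Delta>\<^sub>l \<le> C d (m / v) ^ (l - 1)\<close> for \<open>1 \<le> l \<le> k\<close>, which makes its second
  moment \<open>O((Y / m)\<^sup>2)\<close>. By Cauchy-Schwarz, \<open>D\<^sub>i\<close> restricted to the event that attempt \<open>i\<close> fails has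
  mean \<open>O(\<surd>\<delta> Y / m)\<close>; summed over \<open>i\<close> this is less than the first moment for small \<open>\<epsilon>\<close>. Hence
  some sequence of attempts wins for Maker; a fixed strategy of Breaker needs to be beaten only with
  positive probability, so no concentration inequality is required.
\<close>

section \<open>Subsets and functions on finite sets\<close>

lemma card_nsets_le_power:
  assumes "finite A"
  shows "card (nsets A k) \<le> card A ^ k"
  using assms by (cases "k \<le> card A") (simp_all add: binomial_le_pow binomial_eq_0)

lemma card_nsets_Int_eq_le:
  assumes A: "finite A" "I \<subseteq> A"
  shows "card {J \<in> nsets A k. I \<inter> J = S} \<le> card A ^ (k - card S)"
proof -
  have "card {J \<in> nsets A k. I \<inter> J = S} \<le> card (nsets A (k - card S))"
  proof (rule card_inj_on_le)
    show "inj_on (\<lambda>J. J - I) {J \<in> nsets A k. I \<inter> J = S}"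
      by (rule inj_onI) blast
    show "(\<lambda>J. J - I) ` {J \<in> nsets A k. I \<inter> J = S} \<subseteq> nsets A (k - card S)"
      by (auto simp: nsets_def card_Diff_subset_Int Int_commute)
  qed (simp add: A finite_imp_finite_nsets)
  also have "\<dots> \<le> card A ^ (k - card S)"
    using A(1) by (rule card_nsets_le_power)
  finally show ?thesis .
qed

lemma sum_power_card_Int_nsets_le:
  assumes A: "finite A" and I: "I \<in> nsets A k"
  shows "(\<Sum>J | J \<in> nsets A k \<and> I \<inter> J \<noteq> {}. card A ^ (card (I \<inter> J) - 1))
    \<le> 2 ^ k * card A ^ (k - 1)"
proof -
  let ?\<J> = "{J \<in> nsets A k. I \<inter> J \<noteq> {}}" and ?P = "Pow I - {{}}"
  have fin: "finite I" "I \<subseteq> A" "card I = k" using I by (auto simp: nsets_def)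
  have "(\<Sum>J\<in>?\<J>. card A ^ (card (I \<inter> J) - 1))
      = (\<Sum>S\<in>?P. \<Sum>J | J \<in> ?\<J> \<and> I \<inter> J = S. card A ^ (card (I \<inter> J) - 1))"
    by (rule sum.group[symmetric]) (use A fin in \<open>auto simp: finite_imp_finite_nsets\<close>)
  also have "\<dots> \<le> (\<Sum>S\<in>?P. card A ^ (k - 1))"
  proof (rule sum_mono)
    fix S assume S: "S \<in> ?P"
    then have card_S: "1 \<le> card S" "card S \<le> k"
      using fin card_mono[of I S] by (auto simp: Suc_le_eq card_gt_0_iff intro: finite_subset)
    have "(\<Sum>J | J \<in> ?\<J> \<and> I \<inter> J = S. card A ^ (card (I \<inter> J) - 1))
        = card {J \<in> nsets A k. I \<inter> J = S} * card A ^ (card S - 1)"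
      using S by (simp add: conj_ac cong: conj_cong)
    also have "\<dots> \<le> card A ^ (k - card S) * card A ^ (card S - 1)"
      by (intro mult_right_mono card_nsets_Int_eq_le A fin) simp
    also have "\<dots> = card A ^ (k - 1)"
      using card_S by (simp flip: power_add)
    finally show "(\<Sum>J | J \<in> ?\<J> \<and> I \<inter> J = S. card A ^ (card (I \<inter> J) - 1)) \<le> card A ^ (k - 1)" .
  qed
  also have "\<dots> \<le> 2 ^ k * card A ^ (k - 1)"
    using fin card_mono[of "Pow I" ?P] by (simp add: card_Pow)
  finally show ?thesis .
qed

lemma card_PiE_if:
  assumes A: "finite A" "I \<subseteq> A" and F: "\<And>i. i \<in> I \<Longrightarrow> card (F i) = n"
  shows "card (\<Pi>\<^sub>E i\<in>A. if i \<in> I then F i else V) = n ^ card I * card V ^ (card A - card I)"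
proof -
  have "card (\<Pi>\<^sub>E i\<in>A. if i \<in> I then F i else V) = (\<Prod>i\<in>A. if i \<in> I then n else card V)"
    using A(1) F by (auto simp: card_PiE intro!: prod.cong)
  also have "\<dots> = n ^ card (A \<inter> I) * card V ^ card (A - I)"
    using A(1) by (simp add: prod.If_cases Diff_eq)
  also have "\<dots> = n ^ card I * card V ^ (card A - card I)"
    using A by (simp add: Int_absorb1 card_Diff_subset finite_subset)
  finally show ?thesis .
qed

lemma card_PiE_coordinate_le:
  assumes A: "finite A" "i \<in> A" and V: "finite V"
    and B: "\<And>w. finite (B w)" "\<And>w. card (B w) \<le> b"
    and B_upd: "\<And>w x. B (w(i := x)) = B w"
  shows "card {w \<in> A \<rightarrow>\<^sub>E V. w i \<in> B w} \<le> b * card V ^ (card A - 1)"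
proof -
  let ?U = "(A - {i}) \<rightarrow>\<^sub>E V"
  have "{w \<in> A \<rightarrow>\<^sub>E V. w i \<in> B w} \<subseteq> (\<lambda>(w, x). w(i := x)) ` Sigma ?U B"
  proof
    fix w assume w: "w \<in> {w \<in> A \<rightarrow>\<^sub>E V. w i \<in> B w}"
    have "w(i := undefined) \<in> ?U"
      using w A fun_upd_in_PiE[of i "A - {i}" w "\<lambda>_. V"] by (simp add: insert_absorb)
    then have "(w(i := undefined), w i) \<in> Sigma ?U B" using w by (simp add: B_upd)
    then show "w \<in> (\<lambda>(w, x). w(i := x)) ` Sigma ?U B" by (rule rev_image_eqI) simp
  qed
  then have "card {w \<in> A \<rightarrow>\<^sub>E V. w i \<in> B w} \<le> card (Sigma ?U B)"
    by (rule surj_card_le[rotated]) (use A V B in \<open>auto intro!: finite_PiE\<close>)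
  also have "\<dots> = (\<Sum>w\<in>?U. card (B w))"
    using A V B by (simp add: finite_PiE)
  also have "\<dots> \<le> of_nat (card ?U) * b"
    by (rule sum_bounded_above) (rule B)
  also have "\<dots> = b * card V ^ (card A - 1)"
    using A by (simp add: card_PiE)
  finally show ?thesis .
qed

section \<open>Averages over finite sets\<close>

definition average :: "'a set \<Rightarrow> ('a \<Rightarrow> real) \<Rightarrow> real" where
  "average \<Omega> f = (\<Sum>\<omega>\<in>\<Omega>. f \<omega>) / card \<Omega>"

lemma average_mono: "(\<And>\<omega>. \<omega> \<in> \<Omega> \<Longrightarrow> f \<omega> \<le> g \<omega>) \<Longrightarrow> average \<Omega> f \<le> average \<Omega> g"
  by (simp add: average_def divide_right_mono sum_mono)

lemma average_nonneg: "(\<And>\<omega>. \<omega> \<in> \<Omega> \<Longrightarrow> 0 \<le> f \<omega>) \<Longrightarrow> 0 \<le> average \<Omega> f"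
  by (simp add: average_def sum_nonneg)

lemma average_sum: "average \<Omega> (\<lambda>\<omega>. \<Sum>i\<in>I. f i \<omega>) = (\<Sum>i\<in>I. average \<Omega> (f i))"
  unfolding average_def by (subst sum.swap) (simp add: sum_divide_distrib)

lemma average_of_bool:
  assumes "finite \<Omega>"
  shows "average \<Omega> (\<lambda>\<omega>. of_bool (P \<omega>)) = card {\<omega> \<in> \<Omega>. P \<omega>} / card \<Omega>"
  using assms by (simp add: average_def Int_def)

lemma average_card:
  assumes "finite B"
  shows "average \<Omega> (\<lambda>\<omega>. card {b \<in> B. R \<omega> b}) = (\<Sum>b\<in>B. average \<Omega> (\<lambda>\<omega>. of_bool (R \<omega> b)))"
  unfolding average_sum[symmetric] using assms by (simp add: Int_def)

lemma average_card_square: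
  assumes "finite B"
  shows "average \<Omega> (\<lambda>\<omega>. (real (card {b \<in> B. R \<omega> b}))\<^sup>2)
    = (\<Sum>b\<in>B. \<Sum>c\<in>B. average \<Omega> (\<lambda>\<omega>. of_bool (R \<omega> b \<and> R \<omega> c)))"
proof -
  have "(real (card {b \<in> B. R \<omega> b}))\<^sup>2 = (\<Sum>b\<in>B. \<Sum>c\<in>B. of_bool (R \<omega> b \<and> R \<omega> c))" for \<omega>
  proof -
    have "real (card {b \<in> B. R \<omega> b}) = (\<Sum>b\<in>B. of_bool (R \<omega> b))"
      using assms by (simp add: Int_def)
    then show ?thesis by (simp add: power2_eq_square sum_product of_bool_conj)
  qed
  then show ?thesis by (simp only: average_sum)
qed

lemma average_Cauchy_Schwarz:
  "(average \<Omega> (\<lambda>\<omega>. f \<omega> * g \<omega>))\<^sup>2 \<le> average \<Omega> (\<lambda>\<omega>. (f \<omega>)\<^sup>2) * average \<Omega> (\<lambda>\<omega>. (g \<omega>)\<^sup>2)"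
  using divide_right_mono[OF Cauchy_Schwarz_ineq_sum[of f g \<Omega>], of "(card \<Omega>)\<^sup>2"]
  by (simp add: average_def power_divide power2_eq_square)

section \<open>Uniform hypergraphs\<close>

lemma finite_hverts: "uniform_hypergraph k H \<Longrightarrow> finite (hverts H)"
  by (simp add: uniform_hypergraph_def)

lemma finite_hedges: "uniform_hypergraph k H \<Longrightarrow> finite (hedges H)"
  by (auto simp: uniform_hypergraph_def intro: finite_subset[of _ "Pow (hverts H)"])

lemma hedge_subset_hverts: "uniform_hypergraph k H \<Longrightarrow> e \<in> hedges H \<Longrightarrow> e \<subseteq> hverts H"
  by (simp add: uniform_hypergraph_def)

lemma finite_hedge: "uniform_hypergraph k H \<Longrightarrow> e \<in> hedges H \<Longrightarrow> finite e"
  by (meson finite_hverts finite_subset hedge_subset_hverts)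

lemma card_hedge: "uniform_hypergraph k H \<Longrightarrow> e \<in> hedges H \<Longrightarrow> card e = k"
  by (simp add: uniform_hypergraph_def)

lemma hdeg_le_max_deg:
  assumes "finite (hverts H)" "S \<subseteq> hverts H" "card S = l"
  shows "hdeg H S \<le> max_deg l H"
  unfolding max_deg_def
proof (rule Max_ge)
  have "{hdeg H S | S. S \<subseteq> hverts H \<and> card S = l} \<subseteq> hdeg H ` Pow (hverts H)" by auto
  then show "finite {hdeg H S | S. S \<subseteq> hverts H \<and> card S = l}"
    using assms(1) by (meson finite_Pow_iff finite_imageI finite_subset)
qed (use assms in auto)

lemma card_intersecting_hedges_le:
  assumes H: "uniform_hypergraph k H"
  shows "card {(e, f). e \<in> hedges H \<and> f \<in> hedges H \<and> l \<le> card (e \<inter> f)}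
    \<le> num_edges H * ((k choose l) * max_deg l H)"
proof -
  define N where "N e = (\<Union>S\<in>nsets e l. {f \<in> hedges H. S \<subseteq> f})" for e
  note fin = finite_hedges[OF H]
  have card_N: "card (N e) \<le> (k choose l) * max_deg l H" if e: "e \<in> hedges H" for e
  proof -
    have "card (N e) \<le> (\<Sum>S\<in>nsets e l. hdeg H S)"
      unfolding N_def hdeg_def
      by (rule card_UN_le) (simp add: finite_imp_finite_nsets finite_hedge[OF H e])
    also have "\<dots> \<le> of_nat (card (nsets e l)) * max_deg l H"
      by (rule sum_bounded_above, rule hdeg_le_max_deg)
        (use hedge_subset_hverts[OF H e] finite_hverts[OF H] in \<open>auto simp: nsets_def\<close>)
    also have "\<dots> = (k choose l) * max_deg l H" by (simp add: card_hedge[OF H e])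
    finally show ?thesis .
  qed
  have "{(e, f). e \<in> hedges H \<and> f \<in> hedges H \<and> l \<le> card (e \<inter> f)} \<subseteq> Sigma (hedges H) N"
  proof clarify
    fix e f assume e: "e \<in> hedges H" and f: "f \<in> hedges H" and "l \<le> card (e \<inter> f)"
    then obtain S where "S \<subseteq> e \<inter> f" "card S = l" "finite S"
      by (meson obtain_subset_with_card_n)
    then show "f \<in> N e" using f unfolding N_def nsets_def by blast
  qed
  then have "card {(e, f). e \<in> hedges H \<and> f \<in> hedges H \<and> l \<le> card (e \<inter> f)}
      \<le> card (Sigma (hedges H) N)"
    by (rule card_mono[rotated])
      (use fin in \<open>auto simp: N_def finite_imp_finite_nsets finite_hedge[OF H]\<close>)
  also have "\<dots> = (\<Sum>e\<in>hedges H. card (N e))"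
    using fin by (simp add: N_def finite_imp_finite_nsets finite_hedge[OF H])
  also have "\<dots> \<le> of_nat (card (hedges H)) * ((k choose l) * max_deg l H)"
    by (rule sum_bounded_above) (rule card_N)
  finally show ?thesis by (simp add: num_edges_def)
qed

definition codegree_bounded :: "nat \<Rightarrow> real \<Rightarrow> real \<Rightarrow> 'a hypergraph \<Rightarrow> bool" where
  "codegree_bounded k C p H \<longleftrightarrow>
     (\<forall>l\<in>{1..k}. real (max_deg l H) \<le> C * density H * p ^ (l - 1))"

lemma card_intersecting_hedges_le_if_codegree_bounded:
  assumes H: "uniform_hypergraph k H" and codeg: "codegree_bounded k C p H" and l: "l \<in> {1..k}"
  shows "card {(e, f). e \<in> hedges H \<and> f \<in> hedges H \<and> l \<le> card (e \<inter> f)}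
    \<le> 2 ^ k * C * ((num_edges H)\<^sup>2 / num_verts H) * p ^ (l - 1)"
proof -
  have choose: "real (k choose l) \<le> 2 ^ k"
    using binomial_le_pow2[of k l] by (metis of_nat_le_iff of_nat_numeral of_nat_power)
  have deg: "real (max_deg l H) \<le> C * density H * p ^ (l - 1)"
    using codeg l by (simp add: codegree_bounded_def)
  have "real (card {(e, f). e \<in> hedges H \<and> f \<in> hedges H \<and> l \<le> card (e \<inter> f)})
      \<le> num_edges H * (real (k choose l) * max_deg l H)"
    using of_nat_mono[OF card_intersecting_hedges_le[OF H, of l], where 'a = real] by simp
  also have "\<dots> \<le> num_edges H * (2 ^ k * (C * density H * p ^ (l - 1)))"
    by (intro mult_left_mono mult_mono choose deg) simp_all
  also have "\<dots> = 2 ^ k * C * ((num_edges H)\<^sup>2 / num_verts H) * p ^ (l - 1)"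
    by (simp add: density_def power2_eq_square)
  finally show ?thesis .
qed

section \<open>Random placements of edges\<close>

lemma card_Int_le_card_image_Int:
  assumes "inj_on f A" "finite A"
  shows "card (A \<inter> B) \<le> card (f ` A \<inter> f ` B)"
proof -
  have "card (A \<inter> B) = card (f ` (A \<inter> B))"
    using assms(1) by (metis card_image inf_le1 inj_on_subset)
  also have "\<dots> \<le> card (f ` A \<inter> f ` B)"
    by (rule card_mono) (use assms(2) in auto)
  finally show ?thesis .
qed

lemma card_edge_placements_ge:
  assumes H: "uniform_hypergraph k H" and A: "finite A" and I: "I \<in> nsets A k"
  shows "num_edges H * num_verts H ^ (card A - k) \<le> card {w \<in> A \<rightarrow>\<^sub>E hverts H. w ` I \<in> hedges H}"
proof -
  have fin: "finite I" "card I = k" "I \<subseteq> A" using I by (auto simp: nsets_def)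
  have "\<exists>g. bij_betw g I e" if "e \<in> hedges H" for e
    using that fin by (simp add: finite_same_card_bij finite_hedge[OF H] card_hedge[OF H])
  then obtain g where g: "\<And>e. e \<in> hedges H \<Longrightarrow> bij_betw (g e) I e" by metis
  define P where "P e = (\<Pi>\<^sub>E i\<in>A. if i \<in> I then {g e i} else hverts H)" for e
  have image_P: "w ` I = e" if "e \<in> hedges H" "w \<in> P e" for w e
  proof -
    have "w i = g e i" if "i \<in> I" for i
      using PiE_mem[OF \<open>w \<in> P e\<close>[unfolded P_def], of i] fin that by auto
    then show ?thesis using g[OF that(1)] by (simp add: bij_betw_def image_def)
  qed
  have P_subset: "P e \<subseteq> A \<rightarrow>\<^sub>E hverts H" if "e \<in> hedges H" for e
    unfolding P_def
    by (rule PiE_mono)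
      (use g[OF that] hedge_subset_hverts[OF H that] in \<open>auto simp: bij_betw_def\<close>)
  have fin_\<Omega>: "finite (A \<rightarrow>\<^sub>E hverts H)" using A finite_hverts[OF H] by (simp add: finite_PiE)
  have "num_edges H * num_verts H ^ (card A - k) = (\<Sum>e\<in>hedges H. card (P e))"
    using fin A by (simp add: P_def card_PiE_if[where n = 1] num_edges_def num_verts_def)
  also have "\<dots> = card (\<Union>e\<in>hedges H. P e)"
    by (rule card_UN_disjoint[symmetric])
      (use finite_hedges[OF H] finite_subset[OF P_subset fin_\<Omega>] image_P in blast)+
  also have "\<dots> \<le> card {w \<in> A \<rightarrow>\<^sub>E hverts H. w ` I \<in> hedges H}"
    by (rule card_mono) (use fin_\<Omega> P_subset image_P in auto)
  finally show ?thesis .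
qed

lemma card_edge_pair_placements_le:
  assumes H: "uniform_hypergraph k H" and A: "finite A"
    and I: "I \<in> nsets A k" and J: "J \<in> nsets A k"
  shows "card {w \<in> A \<rightarrow>\<^sub>E hverts H. w ` I \<in> hedges H \<and> w ` J \<in> hedges H}
    \<le> card {(e, f). e \<in> hedges H \<and> f \<in> hedges H \<and> card (I \<inter> J) \<le> card (e \<inter> f)}
      * (k ^ card (I \<union> J) * num_verts H ^ (card A - card (I \<union> J)))"
proof -
  define N where "N = {(e, f). e \<in> hedges H \<and> f \<in> hedges H \<and> card (I \<inter> J) \<le> card (e \<inter> f)}"
  define P where "P = (\<lambda>(e, f). \<Pi>\<^sub>E i\<in>A. if i \<in> I \<union> J then (if i \<in> I then e else f) else hverts H)"
  have IJ: "finite I" "card I = k" "I \<union> J \<subseteq> A" using I J by (auto simp: nsets_def)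
  have fin_N: "finite N"
    by (rule finite_subset[of _ "hedges H \<times> hedges H"]) (auto simp: N_def finite_hedges[OF H])
  have card_P: "card (P (e, f)) = k ^ card (I \<union> J) * num_verts H ^ (card A - card (I \<union> J))"
    if "e \<in> hedges H" "f \<in> hedges H" for e f
    unfolding P_def prod.case num_verts_def
    by (rule card_PiE_if[OF A IJ(3)]) (use that in \<open>simp add: card_hedge[OF H]\<close>)
  have fin_P: "finite (P x)" if "x \<in> N" for x
    unfolding P_def case_prod_beta
    by (rule finite_PiE) (use that A in \<open>auto simp: N_def finite_hverts[OF H] finite_hedge[OF H]\<close>)
  have "{w \<in> A \<rightarrow>\<^sub>E hverts H. w ` I \<in> hedges H \<and> w ` J \<in> hedges H} \<subseteq> (\<Union>x\<in>N. P x)"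
  proof clarify
    fix w assume w: "w \<in> A \<rightarrow>\<^sub>E hverts H" and edges: "w ` I \<in> hedges H" "w ` J \<in> hedges H"
    have "inj_on w I"
      using IJ card_hedge[OF H edges(1)] by (simp add: eq_card_imp_inj_on)
    then have "(w ` I, w ` J) \<in> N"
      using edges IJ by (simp add: N_def card_Int_le_card_image_Int)
    moreover have "w \<in> P (w ` I, w ` J)" using w by (auto simp: P_def PiE_iff)
    ultimately show "w \<in> (\<Union>x\<in>N. P x)" by blast
  qed
  then have "card {w \<in> A \<rightarrow>\<^sub>E hverts H. w ` I \<in> hedges H \<and> w ` J \<in> hedges H} \<le> card (\<Union>x\<in>N. P x)"
    by (rule card_mono[rotated]) (use fin_N fin_P in blast)
  also have "\<dots> \<le> (\<Sum>x\<in>N. card (P x))"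
    using fin_N by (rule card_UN_le)
  also have "\<dots> \<le> of_nat (card N) * (k ^ card (I \<union> J) * num_verts H ^ (card A - card (I \<union> J)))"
    by (rule sum_bounded_above) (auto simp: N_def card_P)
  finally show ?thesis by (simp add: N_def)
qed

lemma card_placements:
  "finite A \<Longrightarrow> card (A \<rightarrow>\<^sub>E hverts H) = num_verts H ^ card A"
  by (simp add: card_PiE num_verts_def)

lemma average_placement_edge_ge:
  assumes H: "uniform_hypergraph k H" and V: "num_verts H > 0"
    and A: "finite A" and I: "I \<in> nsets A k"
  shows "num_edges H / num_verts H ^ k \<le> average (A \<rightarrow>\<^sub>E hverts H) (\<lambda>w. of_bool (w ` I \<in> hedges H))"
proof -
  have "k \<le> card A" using I card_mono[OF A] by (auto simp: nsets_def)
  then have "num_edges H / num_verts H ^ k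
      = real (num_edges H * num_verts H ^ (card A - k)) / num_verts H ^ card A"
    using V by (simp flip: power_add add: divide_simps)
  also have "\<dots> \<le> card {w \<in> A \<rightarrow>\<^sub>E hverts H. w ` I \<in> hedges H} / num_verts H ^ card A"
    by (intro divide_right_mono of_nat_mono card_edge_placements_ge[OF H A I]) simp
  also have "\<dots> = average (A \<rightarrow>\<^sub>E hverts H) (\<lambda>w. of_bool (w ` I \<in> hedges H))"
    using A finite_hverts[OF H] by (simp add: average_of_bool finite_PiE card_placements)
  finally show ?thesis .
qed

lemma average_placement_edge_pair_le:
  assumes H: "uniform_hypergraph k H" and V: "num_verts H > 0" and A: "finite A"
    and codeg: "codegree_bounded k C (card A / num_verts H) H"
    and I: "I \<in> nsets A k" and J: "J \<in> nsets A k" and IJ: "I \<inter> J \<noteq> {}"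
  shows "average (A \<rightarrow>\<^sub>E hverts H) (\<lambda>w. of_bool (w ` I \<in> hedges H \<and> w ` J \<in> hedges H))
    \<le> C * 2 ^ k * real k ^ (2 * k) * (num_edges H / num_verts H ^ k)\<^sup>2
      * card A ^ (card (I \<inter> J) - 1)"
proof -
  define v where "v = real (num_verts H)"
  define l where "l = card (I \<inter> J)"
  let ?m = "card A" and ?e = "real (num_edges H)"
  let ?N = "{(e, f). e \<in> hedges H \<and> f \<in> hedges H \<and> l \<le> card (e \<inter> f)}"
  have IJ_card: "finite I" "finite J" "card I = k" "card J = k" "I \<union> J \<subseteq> A"
    using I J by (auto simp: nsets_def)
  have l: "1 \<le> l" "l \<le> k"
    using IJ IJ_card card_mono[of I "I \<inter> J"] by (auto simp: l_def Suc_le_eq card_gt_0_iff)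
  have card_Un: "card (I \<union> J) = 2 * k - l"
    using card_Un_Int[of I J] IJ_card by (simp add: l_def)
  then have le_m: "2 * k - l \<le> ?m" using card_mono[OF A IJ_card(5)] by simp
  have power_v: "v ^ k * v ^ k = v ^ (2 * k - l) * v ^ (l - 1) * v"
    using l by (simp add: mult_2 flip: power_add power_Suc2)
  have "card {w \<in> A \<rightarrow>\<^sub>E hverts H. w ` I \<in> hedges H \<and> w ` J \<in> hedges H}
      \<le> real (card ?N * (k ^ (2 * k - l) * num_verts H ^ (?m - (2 * k - l))))"
    using card_edge_pair_placements_le[OF H A I J] by (intro of_nat_mono) (simp add: card_Un l_def)
  also have "\<dots> = real (card ?N) * (real k ^ (2 * k - l) * v ^ (?m - (2 * k - l)))"
    by (simp add: v_def)
  also have "\<dots> \<le> (2 ^ k * C * (?e\<^sup>2 / v) * (?m / v) ^ (l - 1))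
      * (real k ^ (2 * k) * v ^ (?m - (2 * k - l)))"
  proof (rule mult_mono')
    show "real (card ?N) \<le> 2 ^ k * C * (?e\<^sup>2 / v) * (?m / v) ^ (l - 1)"
      using card_intersecting_hedges_le_if_codegree_bounded[OF H codeg, of l] l by (simp add: v_def)
    show "real k ^ (2 * k - l) * v ^ (?m - (2 * k - l)) \<le> real k ^ (2 * k) * v ^ (?m - (2 * k - l))"
      using l by (intro mult_right_mono power_increasing) (simp_all add: v_def)
  qed (simp_all add: v_def)
  also have "\<dots> = C * 2 ^ k * real k ^ (2 * k) * (?e / v ^ k)\<^sup>2 * ?m ^ (l - 1) * v ^ ?m"
    using power_v power_diff[OF _ le_m, of v] V
    by (simp add: v_def power_divide power2_eq_square mult_ac)
  finally show ?thesis
    using V A finite_hverts[OF H]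
    by (simp add: average_of_bool finite_PiE card_placements l_def v_def divide_le_eq)
qed

definition edge_indices :: "'a hypergraph \<Rightarrow> nat \<Rightarrow> 'i set \<Rightarrow> ('i \<Rightarrow> 'a) \<Rightarrow> 'i set set" where
  "edge_indices H k A w = {I \<in> nsets A k. w ` I \<in> hedges H}"

lemma finite_edge_indices: "finite A \<Longrightarrow> finite (edge_indices H k A w)"
  by (simp add: edge_indices_def finite_imp_finite_nsets)

lemma average_card_edge_indices_ge:
  assumes H: "uniform_hypergraph k H" and V: "num_verts H > 0" and A: "finite A" "k \<le> card A"
  shows "(card A / k) ^ k * (num_edges H / num_verts H ^ k)
    \<le> average (A \<rightarrow>\<^sub>E hverts H) (\<lambda>w. card (edge_indices H k A w))"
proof -
  have "(card A / k) ^ k * (num_edges H / num_verts H ^ k)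
      \<le> (card A choose k) * (num_edges H / num_verts H ^ k)"
    using A by (intro mult_right_mono binomial_ge_n_over_k_pow_k) auto
  also have "\<dots> = (\<Sum>I\<in>nsets A k. num_edges H / num_verts H ^ k)"
    by simp
  also have "\<dots> \<le> (\<Sum>I\<in>nsets A k. average (A \<rightarrow>\<^sub>E hverts H) (\<lambda>w. of_bool (w ` I \<in> hedges H)))"
    by (intro sum_mono average_placement_edge_ge H V A)
  also have "\<dots> = average (A \<rightarrow>\<^sub>E hverts H) (\<lambda>w. card (edge_indices H k A w))"
    unfolding edge_indices_def using A by (simp add: average_card finite_imp_finite_nsets)
  finally show ?thesis .
qed

lemma sum_power_card_Int_nsets_containing_le:
  assumes A: "finite A" and i: "i \<in> A"
  shows "(\<Sum>I | I \<in> nsets A k \<and> i \<in> I. \<Sum>J | J \<in> nsets A k \<and> i \<in> J. card A ^ (card (I \<inter> J) - 1))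
    \<le> 2 ^ k * (card A ^ (k - 1))\<^sup>2"
proof -
  let ?N = "{I \<in> nsets A k. i \<in> I}"
  have inner: "(\<Sum>J\<in>?N. card A ^ (card (I \<inter> J) - 1)) \<le> 2 ^ k * card A ^ (k - 1)" if I: "I \<in> ?N" for I
  proof -
    have "(\<Sum>J\<in>?N. card A ^ (card (I \<inter> J) - 1))
        \<le> (\<Sum>J | J \<in> nsets A k \<and> I \<inter> J \<noteq> {}. card A ^ (card (I \<inter> J) - 1))"
      using I by (intro sum_mono2) (auto simp: A finite_imp_finite_nsets)
    also have "\<dots> \<le> 2 ^ k * card A ^ (k - 1)"
      using I by (intro sum_power_card_Int_nsets_le A) simp
    finally show ?thesis .
  qed
  have "?N = {J \<in> nsets A k. {i} \<inter> J = {i}}" by auto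
  then have card_N: "card ?N \<le> card A ^ (k - 1)"
    using card_nsets_Int_eq_le[OF A, of "{i}" k "{i}"] i by simp
  have "(\<Sum>I\<in>?N. \<Sum>J\<in>?N. card A ^ (card (I \<inter> J) - 1)) \<le> of_nat (card ?N) * (2 ^ k * card A ^ (k - 1))"
    by (rule sum_bounded_above) (rule inner)
  also have "\<dots> \<le> card A ^ (k - 1) * (2 ^ k * card A ^ (k - 1))"
    using card_N by simp
  finally show ?thesis by (simp add: power2_eq_square mult_ac)
qed

lemma average_card_edge_indices_containing_square_le:
  assumes H: "uniform_hypergraph k H" and V: "num_verts H > 0" and A: "finite A"
    and C: "C \<ge> 0" and codeg: "codegree_bounded k C (card A / num_verts H) H" and i: "i \<in> A"
  shows "average (A \<rightarrow>\<^sub>E hverts H) (\<lambda>w. (real (card {I \<in> edge_indices H k A w. i \<in> I}))\<^sup>2)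
    \<le> C * 4 ^ k * real k ^ (2 * k) * (card A ^ (k - 1) * (num_edges H / num_verts H ^ k))\<^sup>2"
proof -
  let ?\<Omega> = "A \<rightarrow>\<^sub>E hverts H" and ?N = "{I \<in> nsets A k. i \<in> I}"
  define \<kappa> where "\<kappa> = C * 2 ^ k * real k ^ (2 * k) * (num_edges H / num_verts H ^ k)\<^sup>2"
  have \<kappa>: "\<kappa> \<ge> 0" using C by (simp add: \<kappa>_def)
  have fin_N: "finite ?N" using A by (simp add: finite_imp_finite_nsets)
  have "{I \<in> edge_indices H k A w. i \<in> I} = {I \<in> ?N. w ` I \<in> hedges H}" for w
    by (auto simp: edge_indices_def)
  then have "average ?\<Omega> (\<lambda>w. (real (card {I \<in> edge_indices H k A w. i \<in> I}))\<^sup>2)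
      = (\<Sum>I\<in>?N. \<Sum>J\<in>?N. average ?\<Omega> (\<lambda>w. of_bool (w ` I \<in> hedges H \<and> w ` J \<in> hedges H)))"
    by (simp only: average_card_square[OF fin_N])
  also have "\<dots> \<le> (\<Sum>I\<in>?N. \<Sum>J\<in>?N. \<kappa> * card A ^ (card (I \<inter> J) - 1))"
    unfolding \<kappa>_def by (intro sum_mono average_placement_edge_pair_le H V A codeg) auto
  also have "\<dots> = \<kappa> * real (\<Sum>I\<in>?N. \<Sum>J\<in>?N. card A ^ (card (I \<inter> J) - 1))"
    by (simp add: sum_distrib_left)
  also have "\<dots> \<le> \<kappa> * real (2 ^ k * (card A ^ (k - 1))\<^sup>2)"
    by (intro mult_left_mono of_nat_mono sum_power_card_Int_nsets_containing_le A i \<kappa>)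
  also have "\<dots> = C * 4 ^ k * real k ^ (2 * k)
      * (card A ^ (k - 1) * (num_edges H / num_verts H ^ k))\<^sup>2"
    using power_mult_distrib[of "2 :: real" 2 k]
    by (simp add: \<kappa>_def power_mult_distrib power_divide power2_eq_square)
  finally show ?thesis .
qed

section \<open>Maker's random attempts\<close>

lemma breaker_set_subset_hverts:
  assumes "legal_breaker_strategy H q \<sigma>" "play_against H \<sigma> h"
  shows "breaker_set h \<subseteq> hverts H"
  using assms(2)
proof induction
  case start
  show ?case by (simp add: breaker_set_def)
next
  case (round h v)
  then have "\<sigma> h v \<subseteq> hverts H"
    using assms(1) by (auto simp: legal_breaker_strategy_def free_verts_def)
  then show ?case using round by (simp add: breaker_set_def)
qed

lemma card_breaker_set_le:
  assumes "legal_breaker_strategy H q \<sigma>" "play_against H \<sigma> h"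
  shows "card (breaker_set h) \<le> q * length h"
  using assms(2)
proof induction
  case start
  show ?case by (simp add: breaker_set_def)
next
  case (round h v)
  then have "card (\<sigma> h v) \<le> q"
    using assms(1) by (auto simp: legal_breaker_strategy_def)
  then show ?case
    using card_Un_le[of "\<sigma> h v" "breaker_set h"] round by (simp add: breaker_set_def)
qed

text \<open>An attempt at an occupied vertex is dropped without a round being played, so only the number
  of attempts is known in advance.\<close>

primrec attempt_play ::
    "'a hypergraph \<Rightarrow> 'a breaker_strategy \<Rightarrow> (nat \<Rightarrow> 'a) \<Rightarrow> nat \<Rightarrow> 'a history" where
  "attempt_play H \<sigma> w 0 = []"
| "attempt_play H \<sigma> w (Suc i) =
    (let h = attempt_play H \<sigma> w i in if w i \<in> free_verts H h then h @ [(w i, \<sigma> h (w i))] else h)"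

lemma play_against_attempt_play: "play_against H \<sigma> (attempt_play H \<sigma> w i)"
  by (induction i) (auto simp: Let_def intro: play_against.intros)

lemma length_attempt_play_le: "length (attempt_play H \<sigma> w i) \<le> i"
  by (induction i) (auto simp: Let_def)

lemma attempt_play_cong:
  "(\<And>j. j < i \<Longrightarrow> w j = w' j) \<Longrightarrow> attempt_play H \<sigma> w i = attempt_play H \<sigma> w' i"
  by (induction i) (auto simp: Let_def)

lemma maker_set_attempt_play_mono:
  "i \<le> j \<Longrightarrow> maker_set (attempt_play H \<sigma> w i) \<subseteq> maker_set (attempt_play H \<sigma> w j)"
  by (induction j rule: dec_induct) (auto simp: Let_def maker_set_def)

definition attempt_fails ::
    "'a hypergraph \<Rightarrow> 'a breaker_strategy \<Rightarrow> (nat \<Rightarrow> 'a) \<Rightarrow> nat \<Rightarrow> bool" where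
  "attempt_fails H \<sigma> w i \<longleftrightarrow> w i \<in> breaker_set (attempt_play H \<sigma> w i)"

lemma attempt_succeeds:
  assumes "w i \<in> hverts H" "\<not> attempt_fails H \<sigma> w i" "i < m"
  shows "w i \<in> maker_set (attempt_play H \<sigma> w m)"
proof -
  have "w i \<in> maker_set (attempt_play H \<sigma> w (Suc i))"
    using assms(1,2) by (auto simp: attempt_fails_def Let_def maker_set_def free_verts_def)
  then show ?thesis
    using maker_set_attempt_play_mono[of "Suc i" m] assms(3) by (metis Suc_leI subsetD)
qed

lemma card_attempt_fails_le:
  assumes \<sigma>: "legal_breaker_strategy H q \<sigma>" and fin: "finite (hverts H)" and i: "i < m"
  shows "card {w \<in> {..<m} \<rightarrow>\<^sub>E hverts H. attempt_fails H \<sigma> w i} \<le> q * m * num_verts H ^ (m - 1)"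
proof -
  define B where "B w = breaker_set (attempt_play H \<sigma> w i)" for w
  have "card {w \<in> {..<m} \<rightarrow>\<^sub>E hverts H. w i \<in> B w} \<le> q * m * card (hverts H) ^ (card {..<m} - 1)"
  proof (rule card_PiE_coordinate_le[OF _ _ fin])
    show "finite (B w)" for w
      using breaker_set_subset_hverts[OF \<sigma> play_against_attempt_play] fin
      unfolding B_def by (rule finite_subset)
    show "card (B w) \<le> q * m" for w
    proof -
      have "card (B w) \<le> q * length (attempt_play H \<sigma> w i)"
        unfolding B_def by (rule card_breaker_set_le[OF \<sigma> play_against_attempt_play])
      also have "\<dots> \<le> q * m"
        using length_attempt_play_le[of H \<sigma> w i] i by (intro mult_left_mono) auto
      finally show ?thesis .
    qed
    show "B (w(i := x)) = B w" for w x
      unfolding B_def by (rule arg_cong[OF attempt_play_cong]) simp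
  qed (use i in auto)
  then show ?thesis by (simp add: B_def attempt_fails_def num_verts_def)
qed

lemma average_attempt_fails_le:
  assumes \<sigma>: "legal_breaker_strategy H q \<sigma>" and fin: "finite (hverts H)" and i: "i < m"
  shows "average ({..<m} \<rightarrow>\<^sub>E hverts H) (\<lambda>w. of_bool (attempt_fails H \<sigma> w i))
    \<le> real q * real m / num_verts H"
proof -
  have "average ({..<m} \<rightarrow>\<^sub>E hverts H) (\<lambda>w. of_bool (attempt_fails H \<sigma> w i))
      = card {w \<in> {..<m} \<rightarrow>\<^sub>E hverts H. attempt_fails H \<sigma> w i} / num_verts H ^ m"
    using fin by (simp add: average_of_bool finite_PiE card_placements)
  also have "\<dots> \<le> real (q * m * num_verts H ^ (m - 1)) / num_verts H ^ m"
    by (intro divide_right_mono of_nat_mono card_attempt_fails_le \<sigma> fin i) simp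
  also have "\<dots> = real q * real m / num_verts H"
    using i by (cases m) (simp_all add: divide_simps distrib_left)
  finally show ?thesis .
qed

lemma card_edge_indices_le_sum_failed:
  assumes lost: "\<not> maker_has_won H (attempt_play H \<sigma> w m)" and w: "w \<in> {..<m} \<rightarrow> hverts H"
  shows "card (edge_indices H k {..<m} w)
    \<le> (\<Sum>i<m. of_bool (attempt_fails H \<sigma> w i) * card {I \<in> edge_indices H k {..<m} w. i \<in> I})"
proof -
  let ?E = "edge_indices H k {..<m} w" and ?F = "{i \<in> {..<m}. attempt_fails H \<sigma> w i}"
  have "?E \<subseteq> (\<Union>i\<in>?F. {I \<in> ?E. i \<in> I})"
  proof
    fix I assume I: "I \<in> ?E"
    then have I_edge: "I \<subseteq> {..<m}" "w ` I \<in> hedges H"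
      by (auto simp: edge_indices_def nsets_def)
    have "\<not> w ` I \<subseteq> maker_set (attempt_play H \<sigma> w m)"
      using lost I_edge by (auto simp: maker_has_won_def)
    then obtain i where "i \<in> I" "attempt_fails H \<sigma> w i"
      using attempt_succeeds[of w _ H \<sigma> m] I_edge w by blast
    then show "I \<in> (\<Union>i\<in>?F. {I \<in> ?E. i \<in> I})" using I I_edge by blast
  qed
  then have "card ?E \<le> card (\<Union>i\<in>?F. {I \<in> ?E. i \<in> I})"
    by (rule card_mono[rotated]) (simp add: finite_edge_indices)
  also have "\<dots> \<le> (\<Sum>i\<in>?F. card {I \<in> ?E. i \<in> I})"
    by (rule card_UN_le) simp
  also have "\<dots> = (\<Sum>i<m. of_bool (attempt_fails H \<sigma> w i) * card {I \<in> ?E. i \<in> I})"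
    by (rule sum.mono_neutral_cong_left) auto
  finally show ?thesis .
qed

lemma average_failed_edge_indices_le:
  fixes m q :: nat
  assumes H: "uniform_hypergraph k H" and V: "num_verts H > 0" and \<sigma>: "legal_breaker_strategy H q \<sigma>"
    and C: "C \<ge> 0" and codeg: "codegree_bounded k C (m / num_verts H) H" and i: "i < m"
  shows "average ({..<m} \<rightarrow>\<^sub>E hverts H)
      (\<lambda>w. of_bool (attempt_fails H \<sigma> w i) * card {I \<in> edge_indices H k {..<m} w. i \<in> I})
    \<le> sqrt (real q * real m / num_verts H * (C * 4 ^ k * real k ^ (2 * k)))
      * (m ^ (k - 1) * (num_edges H / num_verts H ^ k))"
proof -
  let ?avg = "average ({..<m} \<rightarrow>\<^sub>E hverts H)"
  let ?fails = "\<lambda>w. of_bool (attempt_fails H \<sigma> w i) :: real"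
  let ?D = "\<lambda>w. real (card {I \<in> edge_indices H k {..<m} w. i \<in> I})"
  define K where "K = C * 4 ^ k * real k ^ (2 * k)"
  define y where "y = m ^ (k - 1) * (num_edges H / num_verts H ^ k)"
  have fails: "?avg (\<lambda>w. (?fails w)\<^sup>2) \<le> real q * real m / num_verts H"
    using average_attempt_fails_le[OF \<sigma> finite_hverts[OF H] i]
    by (simp add: power2_eq_square flip: of_bool_conj)
  have D: "?avg (\<lambda>w. (?D w)\<^sup>2) \<le> K * y\<^sup>2"
    using average_card_edge_indices_containing_square_le[OF H V finite_lessThan C, of m i] codeg i
    by (simp add: K_def y_def)
  have "(?avg (\<lambda>w. ?fails w * ?D w))\<^sup>2 \<le> ?avg (\<lambda>w. (?fails w)\<^sup>2) * ?avg (\<lambda>w. (?D w)\<^sup>2)"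
    by (rule average_Cauchy_Schwarz)
  also have "\<dots> \<le> (real q * real m / num_verts H) * (K * y\<^sup>2)"
    by (intro mult_mono fails D) (simp_all add: average_nonneg)
  finally have "?avg (\<lambda>w. ?fails w * ?D w) \<le> sqrt (real q * real m / num_verts H * (K * y\<^sup>2))"
    by (rule real_le_rsqrt)
  also have "\<dots> = sqrt (real q * real m / num_verts H * K) * y"
    by (simp add: real_sqrt_mult real_sqrt_divide y_def mult_ac)
  finally show ?thesis by (simp add: K_def y_def)
qed

lemma average_card_edge_indices_le_if_maker_loses:
  fixes m q :: nat
  assumes H: "uniform_hypergraph k H" and V: "num_verts H > 0" and \<sigma>: "legal_breaker_strategy H q \<sigma>"
    and lost: "\<And>h. play_against H \<sigma> h \<Longrightarrow> \<not> maker_has_won H h"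
    and C: "C \<ge> 0" and codeg: "codegree_bounded k C (m / num_verts H) H"
  shows "average ({..<m} \<rightarrow>\<^sub>E hverts H) (\<lambda>w. card (edge_indices H k {..<m} w))
    \<le> m * (sqrt (real q * real m / num_verts H * (C * 4 ^ k * real k ^ (2 * k)))
      * (m ^ (k - 1) * (num_edges H / num_verts H ^ k)))"
    (is "_ \<le> real m * ?b")
proof -
  let ?avg = "average ({..<m} \<rightarrow>\<^sub>E hverts H)"
  let ?X = "\<lambda>i w. of_bool (attempt_fails H \<sigma> w i) * card {I \<in> edge_indices H k {..<m} w. i \<in> I}"
  have "?avg (\<lambda>w. card (edge_indices H k {..<m} w)) \<le> ?avg (\<lambda>w. real (\<Sum>i<m. ?X i w))"
    by (intro average_mono of_nat_mono card_edge_indices_le_sum_failed lost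
          play_against_attempt_play)
      (simp add: PiE_def)
  also have "\<dots> = (\<Sum>i<m. ?avg (\<lambda>w. real (?X i w)))"
    by (simp only: of_nat_sum average_sum)
  also have "\<dots> \<le> of_nat (card {..<m}) * ?b"
    by (rule sum_bounded_above)
      (use average_failed_edge_indices_le[OF H V \<sigma> C codeg] in simp)
  finally show ?thesis by simp
qed

lemma not_breaker_wins_if_codegree_bounded:
  fixes m q :: nat
  assumes H: "uniform_hypergraph k H" and edges: "num_edges H > 0" and k: "1 \<le> k" and m: "k \<le> m"
    and C: "C \<ge> 0" and codeg: "codegree_bounded k C (m / num_verts H) H"
    and small: "real q * real m / num_verts H * (C * 4 ^ k * real k ^ (4 * k)) < 1"
  shows "\<not> breaker_wins H q"
proof
  assume "breaker_wins H q"
  then obtain \<sigma> where \<sigma>: "legal_breaker_strategy H q \<sigma>"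
    and lost: "\<And>h. play_against H \<sigma> h \<Longrightarrow> \<not> maker_has_won H h"
    unfolding breaker_wins_def by blast
  define c where "c = real q * real m / num_verts H * (C * 4 ^ k * real k ^ (2 * k))"
  define z where "z = real m ^ k * (num_edges H / num_verts H ^ k)"
  obtain e where "e \<in> hedges H" using edges by (auto simp: num_edges_def card_gt_0_iff)
  then have "hverts H \<noteq> {}" using card_hedge[OF H] hedge_subset_hverts[OF H] k by fastforce
  then have V: "num_verts H > 0"
    using finite_hverts[OF H] by (simp add: num_verts_def card_gt_0_iff)
  have z: "z > 0" using edges V k m by (simp add: z_def)
  have "z / k ^ k = (m / k) ^ k * (num_edges H / num_verts H ^ k)"
    by (simp add: z_def power_divide)
  also have "\<dots> \<le> average ({..<m} \<rightarrow>\<^sub>E hverts H) (\<lambda>w. card (edge_indices H k {..<m} w))"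
    using average_card_edge_indices_ge[OF H V finite_lessThan, of m] m by simp
  also have "\<dots> \<le> m * (sqrt c * (m ^ (k - 1) * (num_edges H / num_verts H ^ k)))"
    using average_card_edge_indices_le_if_maker_loses[OF H V \<sigma> lost C codeg] by (simp add: c_def)
  also have "\<dots> = sqrt c * z"
    using k by (cases k) (simp_all add: z_def)
  finally have "1 \<le> sqrt c * real k ^ k"
    using z k by (simp add: divide_le_eq)
  also have "\<dots> = sqrt (c * (real k ^ k)\<^sup>2)"
    by (simp add: real_sqrt_mult)
  also have "c * (real k ^ k)\<^sup>2 = real q * real m / num_verts H * (C * 4 ^ k * real k ^ (4 * k))"
    by (simp add: c_def power2_eq_square flip: power_add)
  finally show False using small by simp
qed

section \<open>The lower bound on the threshold bias\<close>

definition codegree_bias :: "nat \<Rightarrow> 'a hypergraph \<Rightarrow> real" where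
  "codegree_bias k H = (MIN l\<in>{2..k}. (density H / real (max_deg l H)) powr (1 / (real l - 1)))"

lemma density_nonneg: "density H \<ge> 0"
  by (simp add: density_def)

lemma codegree_bias_nonneg:
  assumes "k \<ge> 2"
  shows "codegree_bias k H \<ge> 0"
  unfolding codegree_bias_def by (rule Min.boundedI) (use assms in auto)

lemma codegree_bias_power_le:
  assumes l: "2 \<le> l" "l \<le> k"
  shows "codegree_bias k H ^ (l - 1) \<le> density H / max_deg l H"
proof -
  let ?x = "density H / max_deg l H"
  have "codegree_bias k H \<le> ?x powr (1 / (real l - 1))"
    unfolding codegree_bias_def by (rule Min_le) (use l in auto)
  then have "codegree_bias k H ^ (l - 1) \<le> (?x powr (1 / (real l - 1))) ^ (l - 1)"
    by (rule power_mono) (use l in \<open>simp add: codegree_bias_nonneg\<close>)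
  also have "\<dots> = ?x powr (1 / (real l - 1) * real (l - 1))"
    using l powr_realpow'[of "?x powr (1 / (real l - 1))" "l - 1"] by (simp add: powr_powr)
  also have "\<dots> = ?x"
    using l density_nonneg[of H] by (simp add: of_nat_diff)
  finally show ?thesis .
qed

lemma codegree_bias_posD:
  assumes "codegree_bias k H > 0" "2 \<le> l" "l \<le> k"
  shows "density H > 0" "max_deg l H > 0"
proof -
  have "0 < codegree_bias k H ^ (l - 1)" using assms(1) by simp
  also have "\<dots> \<le> density H / max_deg l H" using assms(2,3) by (rule codegree_bias_power_le)
  finally show "density H > 0" "max_deg l H > 0"
    using density_nonneg[of H] by (simp_all add: zero_less_divide_iff)
qed

lemma max_deg_le_codegree_bias:
  assumes bias: "codegree_bias k H > 0" and l: "2 \<le> l" "l \<le> k"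
  shows "max_deg l H \<le> density H * (1 / codegree_bias k H) ^ (l - 1)"
  using codegree_bias_power_le[OF l, of H] codegree_bias_posD[OF bias l] bias
  by (simp add: power_one_over field_simps)

lemma codegree_bias_le_num_verts:
  assumes k: "k \<ge> 2" and dense: "density H \<le> num_verts H ^ (k - 1)"
  shows "codegree_bias k H \<le> num_verts H"
proof (cases "codegree_bias k H > 0")
  case True
  have "codegree_bias k H ^ (k - 1) \<le> density H / max_deg k H"
    using k by (intro codegree_bias_power_le) auto
  also have "\<dots> \<le> density H"
    using codegree_bias_posD[OF True k] by (simp add: divide_le_eq)
  also note dense
  finally show ?thesis using True k by (simp add: power_mono_iff)
qed simp

lemma codegree_bounded_if_codegree_bias:
  assumes bias: "codegree_bias k H > 0" and C: "C \<ge> 1"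
    and deg1: "max_deg 1 H \<le> C * density H" and p: "1 / codegree_bias k H \<le> p"
  shows "codegree_bounded k C p H"
  unfolding codegree_bounded_def
proof
  fix l assume l: "l \<in> {1..k}"
  show "max_deg l H \<le> C * density H * p ^ (l - 1)"
  proof (cases "l = 1")
    case True
    then show ?thesis using deg1 by simp
  next
    case False
    have "real (max_deg l H) \<le> density H * (1 / codegree_bias k H) ^ (l - 1)"
      using l False by (intro max_deg_le_codegree_bias bias) auto
    also have "\<dots> \<le> C * density H * p ^ (l - 1)"
      using C p bias density_nonneg[of H] mult_right_mono[of 1 C "density H"]
      by (intro mult_mono power_mono) auto
    finally show ?thesis .
  qed
qed

lemma not_breaker_wins_if_less_codegree_bias:
  assumes H: "uniform_hypergraph k H" and k: "k \<ge> 2"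
    and C: "C \<ge> 1" and deg1: "max_deg 1 H \<le> C * density H"
    and dense: "density H \<le> num_verts H ^ (k - 1)"
    and q: "2 * C * 4 ^ k * real k ^ (4 * k + 1) * real q < codegree_bias k H"
  shows "\<not> breaker_wins H q"
proof -
  define v where "v = real (num_verts H)"
  define \<mu> where "\<mu> = codegree_bias k H"
  define r where "r = nat \<lceil>v / \<mu>\<rceil>"
  have "0 \<le> 2 * C * 4 ^ k * real k ^ (4 * k + 1) * real q" using C by simp
  also note q
  finally have bias: "codegree_bias k H > 0" .
  have edges: "num_edges H > 0" and v: "v > 0"
    using codegree_bias_posD(1)[OF bias _ k] by (auto simp: density_def v_def zero_less_divide_iff)
  have \<mu>: "0 < \<mu>" "\<mu> \<le> v"
    using bias codegree_bias_le_num_verts[OF k dense] by (simp_all add: \<mu>_def v_def)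
  then have "1 \<le> v / \<mu>" by simp
  then have r: "1 \<le> r" "v / \<mu> \<le> r" "r \<le> 2 * (v / \<mu>)"
    unfolding r_def by linarith+
  have "v / \<mu> \<le> real (k * r)"
    using r k mult_mono[of 1 "real k" "v / \<mu>" r] \<mu> v by simp
  then have "1 / \<mu> \<le> real (k * r) / v"
    using v by (simp add: field_simps)
  then have codeg: "codegree_bounded k C (real (k * r) / num_verts H) H"
    unfolding \<mu>_def v_def by (rule codegree_bounded_if_codegree_bias[OF bias C deg1])
  have "real q * real (k * r) / v * (C * 4 ^ k * real k ^ (4 * k))
      \<le> real q * (k * (2 * (v / \<mu>))) / v * (C * 4 ^ k * real k ^ (4 * k))"
    using r v C mult_left_mono[OF r(3), of "real k"]
    by (intro mult_right_mono divide_right_mono mult_left_mono) auto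
  also have "\<dots> = 2 * C * 4 ^ k * real k ^ (4 * k + 1) * real q / \<mu>"
    using v by simp
  also have "\<dots> < 1"
    using q \<mu> by (simp add: \<mu>_def)
  finally show ?thesis
    using not_breaker_wins_if_codegree_bounded[OF H edges _ _ _ codeg] k r C by (simp add: v_def)
qed

lemma codegree_bias_le_threshold_bias:
  assumes H: "uniform_hypergraph k H" and k: "k \<ge> 2"
    and C: "C \<ge> 1" and deg1: "max_deg 1 H \<le> C * density H"
    and dense: "density H \<le> num_verts H ^ (k - 1)"
  shows "codegree_bias k H \<le> 2 * C * 4 ^ k * real k ^ (4 * k + 1) * threshold_bias H"
  using not_breaker_wins_if_less_codegree_bias[OF assms, of "threshold_bias H"]
    threshold_bias_pos_wins[OF H k] by (meson not_le)

theorem theorem1p2: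
  fixes k :: nat and H :: "nat \<Rightarrow> 'a hypergraph"
  assumes k: "k \<ge> 2"
    and uniform: "\<And>n. uniform_hypergraph k (H n)"
    and M1: "(\<lambda>n. real (max_deg 1 (H n))) \<in> O(\<lambda>n. density (H n))"
    and M2: "(\<lambda>n. real (max_deg 2 (H n))) \<in> o(\<lambda>n. density (H n))"
    and M3: "(\<lambda>n. density (H n)) \<in> o(\<lambda>n. real (num_verts (H n)) ^ (k - 1))"
  shows "(\<lambda>n. real (threshold_bias (H n))) \<in>
    \<Omega>(\<lambda>n. MIN l\<in>{2..k}. (density (H n) / real (max_deg l (H n))) powr (1 / (real l - 1)))"
proof -
  obtain c where c: "\<forall>\<^sub>F n in sequentially.
      norm (real (max_deg 1 (H n))) \<le> c * norm (density (H n))"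
    using landau_o.bigE[OF M1] by metis
  define C where "C = max c 1"
  have dense: "\<forall>\<^sub>F n in sequentially.
      norm (density (H n)) \<le> 1 * norm (real (num_verts (H n)) ^ (k - 1))"
    by (rule landau_o.smallD[OF M3]) simp
  have "\<forall>\<^sub>F n in sequentially. norm (codegree_bias k (H n))
      \<le> (2 * C * 4 ^ k * real k ^ (4 * k + 1)) * norm (real (threshold_bias (H n)))"
    using c dense
  proof eventually_elim
    case (elim n)
    have "max_deg 1 (H n) \<le> C * density (H n)"
      using elim(1) mult_right_mono[of c C "density (H n)"] by (simp add: C_def density_nonneg)
    then show ?case
      using codegree_bias_le_threshold_bias[OF uniform k, of C n] elim(2) k
      by (simp add: C_def density_nonneg codegree_bias_nonneg)
  qed
  then have "(\<lambda>n. codegree_bias k (H n)) \<in> O(\<lambda>n. real (threshold_bias (H n)))"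
    by (rule bigoI)
  then show ?thesis by (simp add: codegree_bias_def bigomega_iff_bigo)
qed

end
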